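(* Let $X\subset\mathbb{P}^4_{x_1,\dots,x_5}$ be the real cubic threefold given by $$x_4(x_1^2+x_2^2)+ax_5^3+x_5^2(b_1x_1+b_2x_2+b_3x_3+b_4x_4)+x_5\bigl(t_2(x_1+x_2)x_4+t_6(x_3^2+x_4^2)\bigr)=0,$$ with $a,b_1,b_2,b_3,b_4,t_2,t_6\in\mathbb{R}$, such that $X$ has no real singular points, $X_{\mathbb{C}}$ has $2\mathsf{A}_3+2\mathsf{A}_1$-singularities, with the $\mathsf{A}_3$-points at $[1:\pm i:0:0:0]$ and the $\mathsf{A}_1$-points at $[0:0:1:\pm i:0]$, and $X_{\mathbb{C}}$ contains exactly three planes (in particular $t_6\neq 0$). Let $$\Delta(x_5)=-\frac{b_1^2+b_2^2}{4}x_5^3+\frac{-2t_2t_6(b_1+b_2)-b_3^2+4at_6}{4t_6}x_5^2+\left(b_4-\tfrac12t_2^2\right)x_5+t_6\in\mathbb{R}[x_5].$$ Then $X(\mathbb{R})$ is disconnected if and only if $\Delta$ has three real roots $\alpha_1<\alpha_2<\alpha_3$ and one of the following holds: - $t_6>0$ and $0<\alpha_1$, or - $t_6<0$ and $\alpha_3<0$.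
   Context: $X_{\mathbb{C}}$ denotes the base change of $X$ to $\mathbb{C}$. "$X_{\mathbb{C}}$ has $2\mathsf{A}_3+2\mathsf{A}_1$-singularities" means that its singular locus consists of exactly four points, two of type $\mathsf{A}_3$ and two of type $\mathsf{A}_1$, where an $\mathsf{A}_n$-point is locally analytically isomorphic to $x^2+y^2+z^2+w^{n+1}=0$. *)

theory Defs
  imports "HOL-Analysis.Analysis" "HOL-Computational_Algebra.Polynomial"
begin

section \<open>Hypersurfaces in projective space\<close>

text \<open>
  Points of projective space over a field \<open>K\<close> are the lines in \<open>K\<^sup>n\<close>. A projective hypersurface is
  given by the function of a homogeneous form.
\<close>

definition proj_points :: "('a::field ^ 'n) set set" where
  "proj_points = {vec.span {v} | v. v \<noteq> 0}"

definition hypersurface :: "('a::field ^ 'n \<Rightarrow> 'a) \<Rightarrow> ('a ^ 'n) set set" where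
  "hypersurface F = {vec.span {v} | v. v \<noteq> 0 \<and> F v = 0}"

definition partial_deriv ::
  "'n \<Rightarrow> ('a::real_normed_field ^ 'n \<Rightarrow> 'a) \<Rightarrow> 'a ^ 'n \<Rightarrow> 'a" where
  "partial_deriv i F v = deriv (\<lambda>t. F (v + t *s axis i 1)) 0"

definition sing_locus :: "('a::real_normed_field ^ 'n \<Rightarrow> 'a) \<Rightarrow> ('a ^ 'n) set set" where
  "sing_locus F = {vec.span {v} | v. v \<noteq> 0 \<and> F v = 0 \<and> (\<forall>i. partial_deriv i F v = 0)}"

text \<open>Planes (projective dimension 2) are represented by the linear subspaces of dimension 3.\<close>

definition planes_in :: "('a::field ^ 'n \<Rightarrow> 'a) \<Rightarrow> ('a ^ 'n) set set" where
  "planes_in F = {P. vec.subspace P \<and> vec.dim P = 3 \<and> (\<forall>v\<in>P. F v = 0)}"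


section \<open>The Euclidean topology on real projective space\<close>

text \<open>The quotient topology with respect to \<open>v \<mapsto> vec.span {v}\<close> on the nonzero vectors.\<close>

definition real_proj_topology :: "(real ^ 'n) set topology" where
  "real_proj_topology =
     topology (\<lambda>U. U \<subseteq> proj_points \<and> open {v. v \<noteq> 0 \<and> vec.span {v} \<in> U})"

lemma openin_real_proj_topology:
  fixes U :: "(real ^ 'n) set set"
  shows "openin real_proj_topology U \<longleftrightarrow>
    U \<subseteq> proj_points \<and> open {v. v \<noteq> 0 \<and> vec.span {v} \<in> U}"
proof -
  have "istopology (\<lambda>U :: (real ^ 'n) set set.
          U \<subseteq> proj_points \<and> open {v. v \<noteq> 0 \<and> vec.span {v} \<in> U})"
    unfolding istopology_def
  proof (intro conjI allI impI)
    fix S T :: "(real ^ 'n) set set"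
    assume S: "S \<subseteq> proj_points \<and> open {v. v \<noteq> 0 \<and> vec.span {v} \<in> S}"
      and T: "T \<subseteq> proj_points \<and> open {v. v \<noteq> 0 \<and> vec.span {v} \<in> T}"
    show "S \<inter> T \<subseteq> proj_points" using S by blast
    have "{v. v \<noteq> 0 \<and> vec.span {v} \<in> S \<inter> T} =
        {v. v \<noteq> 0 \<and> vec.span {v} \<in> S} \<inter> {v. v \<noteq> 0 \<and> vec.span {v} \<in> T}" by blast
    then show "open {v. v \<noteq> 0 \<and> vec.span {v} \<in> S \<inter> T}"
      using S T by (simp add: open_Int)
  next
    fix \<K> :: "(real ^ 'n) set set set"
    assume K: "\<forall>K\<in>\<K>. K \<subseteq> proj_points \<and> open {v. v \<noteq> 0 \<and> vec.span {v} \<in> K}"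
    show "\<Union>\<K> \<subseteq> proj_points" using K by blast
    have "{v. v \<noteq> 0 \<and> vec.span {v} \<in> \<Union>\<K>} =
        (\<Union>K\<in>\<K>. {v. v \<noteq> 0 \<and> vec.span {v} \<in> K})" by blast
    then show "open {v. v \<noteq> 0 \<and> vec.span {v} \<in> \<Union>\<K>}"
      using K by auto
  qed
  then show ?thesis
    by (simp add: real_proj_topology_def)
qed


section \<open>Singularities of type \<open>A\<^sub>n\<close>\<close>

text \<open>Germs at \<open>p\<close> of holomorphic functions of several variables.\<close>

definition holo_germ :: "(complex ^ 'n \<Rightarrow> complex) \<Rightarrow> complex ^ 'n \<Rightarrow> bool" where
  "holo_germ f p \<longleftrightarrow>
     (\<forall>\<^sub>F z in nhds p. \<exists>D. (f has_derivative D) (at z) \<and> (\<forall>c v. D (c *s v) = c * D v))"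

definition in_germ_ideal ::
  "(complex ^ 'n \<Rightarrow> complex) \<Rightarrow> complex ^ 'n \<Rightarrow> (complex ^ 'n \<Rightarrow> complex) \<Rightarrow> bool" where
  "in_germ_ideal f p h \<longleftrightarrow> (\<exists>k. holo_germ k p \<and> (\<forall>\<^sub>F z in nhds p. h z = k z * f z))"

text \<open>
  Isomorphism of the complex space germs \<open>(V(f), p)\<close> and \<open>(V(g), q)\<close> with structure sheaves
  \<open>\<O>/(f)\<close> and \<open>\<O>/(g)\<close>: morphisms in both directions are induced by holomorphic map germs
  \<open>\<phi>\<close>, \<open>\<psi>\<close> of the ambient spaces, and they are mutually inverse modulo \<open>f\<close> and \<open>g\<close>.
\<close>

definition germ_morphism ::
  "(complex ^ 'n \<Rightarrow> complex) \<Rightarrow> complex ^ 'n \<Rightarrow> (complex ^ 'm \<Rightarrow> complex) \<Rightarrow> complex ^ 'm \<Rightarrow>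
   (complex ^ 'n \<Rightarrow> complex ^ 'm) \<Rightarrow> bool" where
  "germ_morphism f p g q \<phi> \<longleftrightarrow>
     (\<forall>i. holo_germ (\<lambda>z. \<phi> z $ i) p) \<and> \<phi> p = q \<and> in_germ_ideal f p (\<lambda>z. g (\<phi> z))"

definition germ_iso ::
  "(complex ^ 'n \<Rightarrow> complex) \<Rightarrow> complex ^ 'n \<Rightarrow> (complex ^ 'm \<Rightarrow> complex) \<Rightarrow> complex ^ 'm \<Rightarrow> bool"
  where
  "germ_iso f p g q \<longleftrightarrow>
     (\<exists>\<phi> \<psi>. germ_morphism f p g q \<phi> \<and> germ_morphism g q f p \<psi> \<and>
        (\<forall>i. in_germ_ideal f p (\<lambda>z. \<psi> (\<phi> z) $ i - z $ i)) \<and>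
        (\<forall>i. in_germ_ideal g q (\<lambda>w. \<phi> (\<psi> w) $ i - w $ i)))"

text \<open>The chart \<open>\<complex>\<^sup>4 \<rightarrow> \<complex>\<^sup>5\<close> inserting 1 as the coordinate with number \<open>k + 1\<close>, for \<open>k \<le> 4\<close>.\<close>

definition affine_chart :: "nat \<Rightarrow> complex ^ 4 \<Rightarrow> complex ^ 5" where
  "affine_chart k y =
     (let ys = [y $ 1, y $ 2, y $ 3, y $ 4] in vector (take k ys @ 1 # drop k ys))"

definition A_normal_form :: "nat \<Rightarrow> complex ^ 4 \<Rightarrow> complex" where
  "A_normal_form n y = (y $ 1)\<^sup>2 + (y $ 2)\<^sup>2 + (y $ 3)\<^sup>2 + (y $ 4) ^ (n + 1)"

definition is_A_point :: "nat \<Rightarrow> (complex ^ 5 \<Rightarrow> complex) \<Rightarrow> (complex ^ 5) set \<Rightarrow> bool" where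
  "is_A_point n F p \<longleftrightarrow> p \<in> proj_points \<and>
     (\<exists>k\<le>4. \<exists>y. affine_chart k y \<in> p \<and> germ_iso (\<lambda>z. F (affine_chart k z)) y (A_normal_form n) 0)"


section \<open>The cubic threefold and the polynomial \<open>\<Delta>\<close>\<close>

text \<open>
  The coefficients are real; over \<^typ>\<open>real\<close> the form defines \<open>X\<close> and its real points, and over
  \<^typ>\<open>complex\<close> it defines the base change of \<open>X\<close>.
\<close>

definition threefold_form ::
  "real \<Rightarrow> real \<Rightarrow> real \<Rightarrow> real \<Rightarrow> real \<Rightarrow> real \<Rightarrow> real \<Rightarrow> 'a::real_field ^ 5 \<Rightarrow> 'a" where
  "threefold_form a b1 b2 b3 b4 t2 t6 x =
     x $ 4 * ((x $ 1)\<^sup>2 + (x $ 2)\<^sup>2) + of_real a * (x $ 5) ^ 3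
     + (x $ 5)\<^sup>2 * (of_real b1 * x $ 1 + of_real b2 * x $ 2 + of_real b3 * x $ 3 + of_real b4 * x $ 4)
     + x $ 5 * (of_real t2 * (x $ 1 + x $ 2) * x $ 4 + of_real t6 * ((x $ 3)\<^sup>2 + (x $ 4)\<^sup>2))"

definition Delta :: "real \<Rightarrow> real \<Rightarrow> real \<Rightarrow> real \<Rightarrow> real \<Rightarrow> real \<Rightarrow> real \<Rightarrow> real poly" where
  "Delta a b1 b2 b3 b4 t2 t6 =
     [: t6,
        b4 - 1 / 2 * t2\<^sup>2,
        (- 2 * t2 * t6 * (b1 + b2) - b3\<^sup>2 + 4 * a * t6) / (4 * t6),
        - ((b1\<^sup>2 + b2\<^sup>2) / 4) :]"

end

theory Submission
  imports Defs
begin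

text \<open>
  The hyperplanes \<open>x\<^sub>5 = u x\<^sub>4\<close> contain the plane \<open>\<Pi> = {x\<^sub>4 = x\<^sub>5 = 0} \<subseteq> X\<close> and cut out of \<open>X\<close> residual
  quadric surfaces. Completing squares turns the quadric over \<open>u\<close> into
  \<open>y\<^sub>1\<^sup>2 + y\<^sub>2\<^sup>2 + u t\<^sub>6 y\<^sub>3\<^sup>2 + u \<Delta>(u) x\<^sub>4\<^sup>2 = 0\<close>. If \<open>u t\<^sub>6 \<le> 0\<close>, each of its real points is joined to \<open>\<Pi>\<close>
  inside the quadric. If \<open>u t\<^sub>6 > 0\<close>, it has real points only when \<open>u \<Delta>(u) \<le> 0\<close>, is disjoint from
  \<open>\<Pi>\<close>, and its points can reach \<open>\<Pi>\<close> only by \<open>u\<close> tending to infinity. So \<open>X(\<real>)\<close> is connected unless the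
  set of these \<open>u\<close> has a bounded component, which forces three real roots of \<open>\<Delta>\<close> of the sign of \<open>t\<^sub>6\<close>.
  A double root of \<open>\<Delta>\<close> or \<open>t\<^sub>6 = 0\<close> would give a real singular point, and \<open>b\<^sub>1 = b\<^sub>2 = 0\<close> would give a
  fourth plane in \<open>x\<^sub>4 = 0\<close>; hence \<open>\<Delta>\<close> is a cubic with simple roots and negative leading coefficient.
\<close>

section \<open>Vectors of length five\<close>

lemma exhaust_5:
  fixes x :: 5
  shows "x = 1 \<or> x = 2 \<or> x = 3 \<or> x = 4 \<or> x = 5"
proof (induct x)
  case (of_int z)
  then have "z = 0 \<or> z = 1 \<or> z = 2 \<or> z = 3 \<or> z = 4" by fastforce
  then show ?case by auto
qed

lemma forall_5: "(\<forall>i::5. P i) \<longleftrightarrow> P 1 \<and> P 2 \<and> P 3 \<and> P 4 \<and> P 5"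
  by (metis exhaust_5)

lemma vector_5 [simp]:
  "(vector [x1, x2, x3, x4, x5] :: 'a::zero ^ 5) $ 1 = x1"
  "(vector [x1, x2, x3, x4, x5] :: 'a::zero ^ 5) $ 2 = x2"
  "(vector [x1, x2, x3, x4, x5] :: 'a::zero ^ 5) $ 3 = x3"
  "(vector [x1, x2, x3, x4, x5] :: 'a::zero ^ 5) $ 4 = x4"
  "(vector [x1, x2, x3, x4, x5] :: 'a::zero ^ 5) $ 5 = x5"
  unfolding vector_def by simp_all

lemma vec5_eq_iff:
  fixes v w :: "'a ^ 5"
  shows "v = w \<longleftrightarrow> v $ 1 = w $ 1 \<and> v $ 2 = w $ 2 \<and> v $ 3 = w $ 3 \<and> v $ 4 = w $ 4 \<and> v $ 5 = w $ 5"
  by (simp add: vec_eq_iff forall_5)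

lemma axis_5 [simp]:
  "(axis 1 1 :: 'a::zero_neq_one ^ 5) = vector [1, 0, 0, 0, 0]"
  "(axis 2 1 :: 'a::zero_neq_one ^ 5) = vector [0, 1, 0, 0, 0]"
  "(axis 3 1 :: 'a::zero_neq_one ^ 5) = vector [0, 0, 1, 0, 0]"
  "(axis 4 1 :: 'a::zero_neq_one ^ 5) = vector [0, 0, 0, 1, 0]"
  "(axis 5 1 :: 'a::zero_neq_one ^ 5) = vector [0, 0, 0, 0, 1]"
  by (simp_all add: vec5_eq_iff axis_def)

lemma continuous_on_vector_5 [continuous_intros]:
  fixes f1 f2 f3 f4 f5 :: "'a::topological_space \<Rightarrow> 'b::real_normed_vector"
  assumes "continuous_on S f1" "continuous_on S f2" "continuous_on S f3"
    "continuous_on S f4" "continuous_on S f5"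
  shows "continuous_on S (\<lambda>x. vector [f1 x, f2 x, f3 x, f4 x, f5 x] :: 'b ^ 5)"
proof -
  have "\<forall>i::5. continuous_on S (\<lambda>x. (vector [f1 x, f2 x, f3 x, f4 x, f5 x] :: 'b ^ 5) $ i)"
    using assms by (simp add: forall_5)
  then have "continuous_on S (\<lambda>x. \<chi> i. (vector [f1 x, f2 x, f3 x, f4 x, f5 x] :: 'b ^ 5) $ i)"
    by (intro continuous_on_vec_lambda) blast
  then show ?thesis by simp
qed

section \<open>Projective space\<close>

lemma topspace_real_proj_topology:
  "topspace real_proj_topology = (proj_points :: (real ^ 'n) set set)"
proof -
  have "{v::real^'n. v \<noteq> 0 \<and> vec.span {v} \<in> proj_points} = - {0}"
    by (auto simp: proj_points_def)
  then have "openin real_proj_topology (proj_points :: (real^'n) set set)"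
    by (simp add: openin_real_proj_topology open_Compl)
  then have "proj_points \<subseteq> topspace (real_proj_topology :: (real ^ 'n) set topology)"
    by (rule openin_subset)
  moreover have "topspace (real_proj_topology :: (real ^ 'n) set topology) \<subseteq> proj_points"
    using openin_topspace[of "real_proj_topology :: (real ^ 'n) set topology"]
    unfolding openin_real_proj_topology by simp
  ultimately show ?thesis by (rule subset_antisym[rotated])
qed

lemma continuous_map_span:
  "continuous_map (top_of_set (- {0})) real_proj_topology (\<lambda>v :: real ^ 'n. vec.span {v})"
  unfolding continuous_map_def
proof (intro conjI ballI allI impI)
  show "(\<lambda>v::real^'n. vec.span {v}) \<in> topspace (top_of_set (- {0})) \<rightarrow> topspace real_proj_topology"
    by (auto simp: topspace_real_proj_topology proj_points_def)
  fix U :: "(real^'n) set set"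
  assume "openin real_proj_topology U"
  then have "open {v. v \<noteq> 0 \<and> vec.span {v} \<in> U}"
    by (simp add: openin_real_proj_topology)
  moreover have "{x \<in> topspace (top_of_set (- {0})). vec.span {x} \<in> U} = - {0} \<inter> {v. v \<noteq> 0 \<and> vec.span {v} \<in> U}"
    by auto
  ultimately show "openin (top_of_set (- {0})) {x \<in> topspace (top_of_set (- {0})). vec.span {x} \<in> U}"
    by (simp only: openin_open_Int)
qed

text \<open>The hypersurface is the continuous image of its cone without the origin, so
  connectedness may be proved with paths of vectors.\<close>

lemma connectedin_hypersurface:
  fixes F :: "real ^ 'n \<Rightarrow> real"
  assumes "connected {v. v \<noteq> 0 \<and> F v = 0}"
  shows "connectedin real_proj_topology (hypersurface F)"
proof -
  have "hypersurface F = (\<lambda>v. vec.span {v}) ` {v. v \<noteq> 0 \<and> F v = 0}"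
    by (auto simp: hypersurface_def)
  moreover have "connectedin (top_of_set (- {0})) {v. v \<noteq> 0 \<and> F v = 0}"
    using assms by (auto simp: connectedin_subtopology connectedin_iff_connected)
  ultimately show ?thesis
    using connectedin_continuous_map_image[OF continuous_map_span, of "{v. v \<noteq> 0 \<and> F v = 0}"] by simp
qed

text \<open>A separation of the cone would not suffice, since \<open>v\<close> and \<open>-v\<close>
  give the same point and might lie in different pieces. Projective space is the unit sphere modulo
  antipodes, so a separation of the zeros on the sphere into antipodally symmetric closed sets
  descends.\<close>

lemma not_connectedin_hypersurface:
  fixes F :: "real ^ 'n \<Rightarrow> real"
  assumes hom: "\<And>c v. c \<noteq> 0 \<Longrightarrow> F v = 0 \<Longrightarrow> F (c *s v) = 0"
    and S: "closed S1" "closed S2" "S1 \<inter> S2 = {}" "S1 \<noteq> {}" "S2 \<noteq> {}"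
    and un: "S1 \<union> S2 = {v. norm v = 1 \<and> F v = 0}"
    and sym: "\<And>v. v \<in> S1 \<Longrightarrow> - v \<in> S1" "\<And>v. v \<in> S2 \<Longrightarrow> - v \<in> S2"
  shows "\<not> connectedin real_proj_topology (hypersurface F)"
proof -
  define q where "q = (\<lambda>v :: real^'n. vec.span {v})"
  define n where "n = (\<lambda>v :: real^'n. (1 / norm v) *\<^sub>R v)"
  have q_scale: "q (c *\<^sub>R v) = q v" if "c \<noteq> 0" for c v
    unfolding q_def by (metis vec.span_image_scale[of "{v}" "\<lambda>_. c"] that finite.emptyI finite_insert image_insert image_empty scalar_mult_eq_scaleR empty_iff insert_iff)
  have q_n: "q (n v) = q v" if "v \<noteq> 0" for v
    unfolding n_def using that by (intro q_scale) auto
  have n_norm: "norm (n v) = 1" if "v \<noteq> 0" for v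
    using that by (simp add: n_def)
  have q_eq: "w = v \<or> w = - v" if "q v = q w" "norm v = 1" "norm w = 1" for v w
  proof -
    have "w \<in> vec.span {v}" using that(1) by (simp add: q_def vec.span_base)
    then obtain c where c: "w = c *s v" by (auto simp: vec.span_singleton)
    then have "\<bar>c\<bar> = 1" using that by (simp add: scalar_mult_eq_scaleR)
    then have "c = 1 \<or> c = -1" by linarith
    then show ?thesis using c by (auto simp: scalar_mult_eq_scaleR)
  qed
  \<comment> \<open>Symmetry makes \<open>S\<close> a union of fibres of \<open>q\<close> on the
    sphere, so membership in the image can be tested on the normalized vector.\<close>
  have in_iff: "q v \<in> q ` S \<longleftrightarrow> n v \<in> S" 
    if vS: "v \<noteq> 0" "S \<subseteq> {v. norm v = 1}" "\<And>v. v \<in> S \<Longrightarrow> - v \<in> S" for v S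
  proof
    assume "q v \<in> q ` S"
    then obtain w where w: "w \<in> S" "q (n v) = q w" using q_n[OF vS(1)] by (metis imageE)
    moreover have "norm w = 1" using w vS(2) by auto
    ultimately have "w = n v \<or> w = - n v" using q_eq[of "n v" w] n_norm vS(1) by auto
    then show "n v \<in> S" using w(1) vS(3)[of w] by (metis minus_minus)
  next
    assume "n v \<in> S"
    then show "q v \<in> q ` S" using q_n[OF vS(1)] by (metis imageI)
  qed
  have S1u: "S1 \<subseteq> {v. norm v = 1}" and S2u: "S2 \<subseteq> {v. norm v = 1}" using un by auto
  have opn: "openin real_proj_topology (proj_points - q ` S)"
    if "closed S" "S \<subseteq> {v. norm v = 1}" "\<And>v. v \<in> S \<Longrightarrow> - v \<in> S" for S
  proof -
    have "{v. v \<noteq> 0 \<and> vec.span {v} \<in> proj_points - q ` S} = (- {0}) \<inter> n -` (- S)"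
    proof (intro set_eqI)
      fix v
      show "v \<in> {v. v \<noteq> 0 \<and> vec.span {v} \<in> proj_points - q ` S} \<longleftrightarrow> v \<in> (- {0}) \<inter> n -` (- S)"
      proof (cases "v = 0")
        case False
        have "vec.span {v} \<in> proj_points" using False by (auto simp: proj_points_def)
        then show ?thesis using in_iff[OF False that(2,3)] False by (auto simp: q_def)
      qed simp
    qed
    moreover have "open ((- {0}) \<inter> n -` (- S))"
    proof (rule continuous_open_preimage)
      show "continuous_on (- {0}) n" unfolding n_def by (intro continuous_intros) auto
    qed (use that(1) in auto)
    ultimately show ?thesis by (simp add: openin_real_proj_topology)
  qed
  have hyp: "hypersurface F = q ` S1 \<union> q ` S2"
  proof -
    have "hypersurface F = q ` {v. norm v = 1 \<and> F v = 0}"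
    proof (intro equalityI subsetI)
      fix x assume "x \<in> hypersurface F"
      then obtain v where v: "v \<noteq> 0" "F v = 0" "x = q v" by (auto simp: hypersurface_def q_def)
      have "F (n v) = 0" using hom[of "1 / norm v" v] v by (simp add: n_def scalar_mult_eq_scaleR)
      then show "x \<in> q ` {v. norm v = 1 \<and> F v = 0}"
        using n_norm v q_n by (metis (mono_tags, lifting) imageI mem_Collect_eq)
    next
      fix x assume "x \<in> q ` {v. norm v = 1 \<and> F v = 0}"
      then show "x \<in> hypersurface F" by (force simp: hypersurface_def q_def)
    qed
    then show ?thesis using un by (metis image_Un)
  qed
  have disj: "q ` S1 \<inter> q ` S2 = {}"
  proof -
    have "q v \<notin> q ` S2" if "v \<in> S1" for v
    proof -
      have "norm v = 1" using that S1u by auto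
      then have "v \<noteq> 0" "n v = v" by (auto simp: n_def)
      then show ?thesis using in_iff[OF _ S2u sym(2), of v] that S(3) by auto
    qed
    then show ?thesis by auto
  qed
  have sub: "hypersurface F \<subseteq> proj_points" by (auto simp: hypersurface_def proj_points_def)
  show ?thesis
  proof
    assume "connectedin real_proj_topology (hypersurface F)"
    then have "\<not> (\<exists>E1 E2. openin real_proj_topology E1 \<and> openin real_proj_topology E2 \<and>
        hypersurface F \<subseteq> E1 \<union> E2 \<and> E1 \<inter> E2 \<inter> hypersurface F = {} \<and>
        E1 \<inter> hypersurface F \<noteq> {} \<and> E2 \<inter> hypersurface F \<noteq> {})"
      by (simp add: connectedin)
    moreover have "hypersurface F \<subseteq> (proj_points - q ` S1) \<union> (proj_points - q ` S2)"
      using disj sub by auto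
    moreover have "(proj_points - q ` S1) \<inter> (proj_points - q ` S2) \<inter> hypersurface F = {}"
      using hyp by auto
    moreover have "q ` S2 \<subseteq> (proj_points - q ` S1) \<inter> hypersurface F"
      "q ` S1 \<subseteq> (proj_points - q ` S2) \<inter> hypersurface F"
      using hyp sub disj by auto
    ultimately show False
      using opn[OF S(1) S1u sym(1)] opn[OF S(2) S2u sym(2)] S(4,5)
      by (metis (no_types, lifting) image_is_empty subset_empty)
  qed
qed

section \<open>Real cubics\<close>

text \<open>The first divided differences at \<open>x, y\<close> and \<open>x, z\<close> vanish,
  hence so does the second one. These relations express all coefficients through \<open>c3\<close>
  and the roots.\<close>

lemma cubic_factorization:
  fixes c0 c1 c2 c3 x y z s :: "'a::field"
  assumes ne: "x \<noteq> y" "x \<noteq> z" "y \<noteq> z"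
    and r: "poly [:c0, c1, c2, c3:] x = 0" "poly [:c0, c1, c2, c3:] y = 0"
      "poly [:c0, c1, c2, c3:] z = 0"
  shows "poly [:c0, c1, c2, c3:] s = c3 * (s - x) * (s - y) * (s - z)"
proof -
  have xy: "(x - y) * (c1 + c2 * (x + y) + c3 * (x * x + x * y + y * y)) = 0"
    using r(1,2) by simp algebra
  have xz: "(x - z) * (c1 + c2 * (x + z) + c3 * (x * x + x * z + z * z)) = 0"
    using r(1,3) by simp algebra
  have 1: "c1 + c2 * (x + y) + c3 * (x * x + x * y + y * y) = 0" using xy ne by simp
  have 2: "c1 + c2 * (x + z) + c3 * (x * x + x * z + z * z) = 0" using xz ne by simp
  have "(y - z) * (c2 + c3 * (x + y + z)) = 0" using 1 2 by algebra
  then have 3: "c2 + c3 * (x + y + z) = 0" using ne by simp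
  show ?thesis using 1 3 r(1) by simp algebra
qed

text \<open>For \<open>M \<ge> 1\<close> the lower terms are at most \<open>K * M\<^sup>2\<close>,
  and the leading term beats this bound once \<open>M\<close> exceeds
  \<open>K / (- c3)\<close>.\<close>

lemma cubic_neg_at_infinity:
  fixes c0 c1 c2 c3 q :: real
  assumes "c3 < 0"
  obtains M where "M > q" "M > 0" "poly [:c0, c1, c2, c3:] M < 0"
proof -
  define K where "K = \<bar>c0\<bar> + \<bar>c1\<bar> + \<bar>c2\<bar>"
  define M where "M = max (max 1 (q + 1)) (K / (- c3) + 1)"
  have M: "M \<ge> 1" "M > q" "M > K / (- c3)" by (auto simp: M_def)
  have "K < - c3 * M" using M(3) assms by (simp add: field_simps)
  then have neg: "K + c3 * M < 0" by simp
  have "c0 \<le> \<bar>c0\<bar> * M\<^sup>2"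
    using M(1) mult_left_mono[of 1 "M\<^sup>2" "\<bar>c0\<bar>"] by (simp add: one_le_power)
  moreover have "c1 * M \<le> \<bar>c1\<bar> * M\<^sup>2"
    using M(1) mult_mono[of c1 "\<bar>c1\<bar>" M "M\<^sup>2"] by (simp add: self_le_power)
  moreover have "c2 * M\<^sup>2 \<le> \<bar>c2\<bar> * M\<^sup>2"
    by (intro mult_right_mono) auto
  ultimately have "poly [:c0, c1, c2, c3:] M \<le> M\<^sup>2 * (K + c3 * M)"
    by (simp add: K_def algebra_simps power2_eq_square)
  also have "\<dots> < 0" using neg M(1) by (intro mult_pos_neg) auto
  finally show ?thesis using that M by force
qed

text \<open>The signs at 0, near \<open>p\<close>, at \<open>q\<close> and far to the right are +,
  -, +, -, so the intermediate value theorem gives three roots, and a cubic has no more.\<close>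

lemma cubic_three_positive_roots:
  fixes c0 c1 c2 c3 p q :: real
  assumes c: "c0 > 0" "c3 < 0"
    and simple: "\<And>s. poly [:c0, c1, c2, c3:] s = 0 \<Longrightarrow> poly (pderiv [:c0, c1, c2, c3:]) s \<noteq> 0"
    and pq: "0 < p" "p < q" "poly [:c0, c1, c2, c3:] p \<le> 0" "poly [:c0, c1, c2, c3:] q > 0"
  obtains x y z where "0 < x" "x < y" "y < z" "{s. poly [:c0, c1, c2, c3:] s = 0} = {x, y, z}"
proof -
  let ?g = "[:c0, c1, c2, c3:]"
  \<comment> \<open>If \<open>p\<close> is itself a root, its simplicity allows a small move, to the
    right or left according to the sign of the derivative, to a strictly negative value.\<close>
  obtain p' where p': "0 < p'" "p' < q" "poly ?g p' < 0"
  proof (cases "poly ?g p = 0")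
    case False
    then show ?thesis using that pq by auto
  next
    case True
    have d: "DERIV (poly ?g) p :> poly (pderiv ?g) p" by (rule poly_DERIV)
    consider "poly (pderiv ?g) p < 0" | "poly (pderiv ?g) p > 0" using simple[OF True] by linarith
    then show ?thesis
    proof cases
      case 1
      then obtain e where e: "e > 0" "\<forall>h>0. h < e \<longrightarrow> poly ?g (p + h) < poly ?g p"
        using DERIV_neg_dec_right[OF d] by auto
      define h where "h = min (e / 2) ((q - p) / 2)"
      have "h > 0" "h < e" "p + h < q" using e pq by (auto simp: h_def min_def field_simps)
      then show ?thesis using e(2) True that[of "p + h"] pq by auto
    next
      case 2
      then obtain e where e: "e > 0" "\<forall>h>0. h < e \<longrightarrow> poly ?g (p - h) < poly ?g p"
        using DERIV_pos_inc_left[OF d] by auto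
      define h where "h = min (e / 2) (p / 2)"
      have "h > 0" "h < e" "p - h > 0" using e pq by (auto simp: h_def min_def field_simps)
      then show ?thesis using e(2) True that[of "p - h"] pq by auto
    qed
  qed
  have "poly ?g 0 > 0" using c by simp
  then obtain x where x: "0 < x" "x < p'" "poly ?g x = 0" using poly_IVT_neg[of 0 p' ?g] p' by auto
  obtain y where y: "p' < y" "y < q" "poly ?g y = 0" using poly_IVT_pos[of p' q ?g] p' pq by auto
  obtain M where M: "M > q" "poly ?g M < 0" using cubic_neg_at_infinity[OF c(2)] by metis
  obtain z where z: "q < z" "z < M" "poly ?g z = 0" using poly_IVT_neg[of q M ?g] M pq by auto
  have o: "x < y" "y < z" using x y z by auto
  have "poly ?g s = c3 * (s - x) * (s - y) * (s - z)" for s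
    by (rule cubic_factorization) (use o x(3) y(3) z(3) in \<open>auto simp del: poly_pCons\<close>)
  then have "{s. poly ?g s = 0} = {x, y, z}" using c by auto
  then show ?thesis using that x o by blast
qed

section \<open>The quadric bundle structure\<close>

lemma threefold_form_scale:
  "threefold_form a b1 b2 b3 b4 t2 t6 (c *s v) = c ^ 3 * threefold_form a b1 b2 b3 b4 t2 t6 v"
  by (simp add: threefold_form_def power2_eq_square power3_eq_cube algebra_simps)

text \<open>On the hyperplane \<open>x\<^sub>5 = u x\<^sub>4\<close> the form is \<open>x\<^sub>4\<close> times a quadratic form, here diagonalized.\<close>

lemma threefold_form_fibre:
  fixes v :: "real ^ 5"
  assumes t6: "t6 \<noteq> 0" and u: "v $ 5 = u * v $ 4"
  shows "threefold_form a b1 b2 b3 b4 t2 t6 v = v $ 4 *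
    ((v $ 1 + v $ 4 * (u * t2 + u\<^sup>2 * b1) / 2)\<^sup>2 + (v $ 2 + v $ 4 * (u * t2 + u\<^sup>2 * b2) / 2)\<^sup>2
     + u * t6 * (v $ 3 + v $ 4 * u * b3 / (2 * t6))\<^sup>2
     + u * poly (Delta a b1 b2 b3 b4 t2 t6) u * (v $ 4)\<^sup>2)"
  unfolding threefold_form_def Delta_def u using t6
  by (simp add: power2_eq_square power3_eq_cube field_simps)

text \<open>Unlike the diagonal form, this one stays polynomial in \<open>v\<close> and \<open>u\<close>, so it makes sense on
  \<open>x\<^sub>4 = x\<^sub>5 = 0\<close> too.\<close>

lemma threefold_form_hyperplane:
  fixes v :: "real ^ 5"
  assumes u: "v $ 5 = u * v $ 4"
  shows "threefold_form a b1 b2 b3 b4 t2 t6 v = v $ 4 *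
    ((v $ 1)\<^sup>2 + (v $ 2)\<^sup>2 + a * u ^ 3 * (v $ 4)\<^sup>2
     + u\<^sup>2 * v $ 4 * (b1 * v $ 1 + b2 * v $ 2 + b3 * v $ 3 + b4 * v $ 4)
     + u * (t2 * (v $ 1 + v $ 2) * v $ 4 + t6 * ((v $ 3)\<^sup>2 + (v $ 4)\<^sup>2)))"
  unfolding threefold_form_def u
  by (simp add: power2_eq_square power3_eq_cube algebra_simps)

lemma continuous_on_threefold_form:
  "continuous_on S (threefold_form a b1 b2 b3 b4 t2 t6 :: real ^ 5 \<Rightarrow> real)"
  unfolding threefold_form_def by (intro continuous_intros)

section \<open>Disconnectedness\<close>

text \<open>Over \<open>u = l\<close> and \<open>u = m\<close> the diagonal form is positive
  definite, so these fibres have no real points off the plane. They cut off the part over the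
  interval between them, which \<open>s\<close> shows to be nonempty.\<close>

lemma threefold_disconnected:
  fixes a b1 b2 b3 b4 t2 t6 l m :: real
  defines "F \<equiv> threefold_form a b1 b2 b3 b4 t2 t6 :: real ^ 5 \<Rightarrow> real"
    and "D \<equiv> poly (Delta a b1 b2 b3 b4 t2 t6)"
  assumes lm: "l * t6 > 0" "m * t6 > 0" "l * D l > 0" "m * D m > 0"
    and s: "l < s" "s < m" "s * D s \<le> 0"
  shows "\<not> connectedin real_proj_topology (hypersurface F)"
proof -
  have t6: "t6 \<noteq> 0" using lm by auto
  have ut: "u * t6 > 0" if "l \<le> u" "u \<le> m" for u
    using that lm by (smt (verit) mult_less_cancel_right zero_less_mult_iff)
  define Q where "Q = (\<lambda>(v :: real^5, u :: real). (v $ 1)\<^sup>2 + (v $ 2)\<^sup>2 + a * u ^ 3 * (v $ 4)\<^sup>2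
     + u\<^sup>2 * v $ 4 * (b1 * v $ 1 + b2 * v $ 2 + b3 * v $ 3 + b4 * v $ 4)
     + u * (t2 * (v $ 1 + v $ 2) * v $ 4 + t6 * ((v $ 3)\<^sup>2 + (v $ 4)\<^sup>2)))"
  have FQ: "F v = v $ 4 * Q (v, u)" if "v $ 5 = u * v $ 4" for v u
    using threefold_form_hyperplane[OF that] by (simp add: F_def Q_def)
  text \<open>The part of \<open>X\<close> over \<open>[l, m]\<close>: adjoining \<open>u\<close> as a coordinate excludes the plane
    \<open>x\<^sub>4 = x\<^sub>5 = 0\<close>, and compactness makes this part closed in the sphere.\<close>
  define K where "K = {w \<in> sphere (0 :: real^5) 1 \<times> {l..m}. fst w $ 5 = snd w * fst w $ 4 \<and> Q w = 0}"
  define S1 where "S1 = fst ` K"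
  \<comment> \<open>With \<open>v $ 5 = u * v $ 4\<close>, \<open>P v\<close> equals
    \<open>(u - l) * (m - u) * (v $ 4)\<^sup>2\<close>: a homogeneous test for \<open>u\<close>
    between \<open>l\<close> and \<open>m\<close> that also makes sense where x4 = 0.\<close>
  define P where "P = (\<lambda>v :: real^5. (v $ 5 - l * v $ 4) * (m * v $ 4 - v $ 5))"
  define S2 where "S2 = {v \<in> sphere 0 1. F v = 0 \<and> P v \<le> 0}"
  have Fc: "continuous_on S F" for S unfolding F_def by (rule continuous_on_threefold_form)
  have "closed K"
  proof -
    have "K = (sphere 0 1 \<times> {l..m}) \<inter> ({w. fst w $ 5 = snd w * fst w $ 4} \<inter> {w. Q w = 0})"
      by (auto simp: K_def)
    moreover have "closed {w :: (real^5) \<times> real. fst w $ 5 = snd w * fst w $ 4}"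
      by (intro closed_Collect_eq continuous_intros)
    moreover have "closed {w. Q w = 0}"
      unfolding Q_def case_prod_unfold by (intro closed_Collect_eq continuous_intros)
    ultimately show ?thesis by (auto intro!: closed_Int closed_Times)
  qed
  then have "compact ((sphere 0 1 \<times> {l..m}) \<inter> K)"
    by (intro compact_Int_closed compact_Times) auto
  moreover have "(sphere 0 1 \<times> {l..m}) \<inter> K = K" by (auto simp: K_def)
  ultimately have "compact K" by simp
  then have S1c: "closed S1"
    unfolding S1_def by (intro compact_imp_closed compact_continuous_image continuous_intros)
  have S2c: "closed S2"
  proof -
    have "S2 = sphere 0 1 \<inter> ({v. F v = 0} \<inter> {v. P v \<le> 0})" by (auto simp: S2_def)
    moreover have "closed {v. F v = 0}" by (intro closed_Collect_eq Fc continuous_intros)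
    moreover have "closed {v. P v \<le> 0}"
      unfolding P_def by (intro closed_Collect_le continuous_intros)
    ultimately show ?thesis by auto
  qed
  have Dle: "u * D u \<le> 0"
    if "v $ 5 = u * v $ 4" "v $ 4 \<noteq> 0" "F v = 0" "l \<le> u" "u \<le> m" for u and v :: "real^5"
  proof -
    have "(v $ 1 + v $ 4 * (u * t2 + u\<^sup>2 * b1) / 2)\<^sup>2 + (v $ 2 + v $ 4 * (u * t2 + u\<^sup>2 * b2) / 2)\<^sup>2
     + u * t6 * (v $ 3 + v $ 4 * u * b3 / (2 * t6))\<^sup>2 + u * D u * (v $ 4)\<^sup>2 = 0"
      using threefold_form_fibre[OF t6 that(1), of a b1 b2 b3 b4 t2] that(2,3)
      unfolding F_def D_def by simp
    moreover have "u * t6 * (v $ 3 + v $ 4 * u * b3 / (2 * t6))\<^sup>2 \<ge> 0"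
      using ut[OF that(4,5)] by simp
    ultimately have "u * D u * (v $ 4)\<^sup>2 \<le> 0"
      by (smt (verit) zero_le_power2)
    then show ?thesis using that(2) by (simp add: mult_le_0_iff)
  qed
  have S1p: "norm v = 1 \<and> F v = 0 \<and> P v > 0" if vS1: "v \<in> S1" for v
  proof -
    obtain u where u: "norm v = 1" "l \<le> u" "u \<le> m" "v $ 5 = u * v $ 4" "Q (v, u) = 0"
      using vS1 by (auto simp: S1_def K_def)
    have F0: "F v = 0" using FQ[OF u(4)] u(5) by simp
    \<comment> \<open>On x4 = 0 the form \<open>Q\<close> has coefficients 1, 1,
      \<open>u * t6\<close>, all positive, so only the zero vector would remain.\<close>
    have "v $ 4 \<noteq> 0"
    proof
      assume 4: "v $ 4 = 0"
      then have "(v $ 1)\<^sup>2 + (v $ 2)\<^sup>2 + u * t6 * (v $ 3)\<^sup>2 = 0" using u(5) by (simp add: Q_def)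
      moreover have "u * t6 * (v $ 3)\<^sup>2 \<ge> 0" using ut[OF u(2,3)] by simp
      ultimately have "(v $ 1)\<^sup>2 = 0 \<and> (v $ 2)\<^sup>2 = 0 \<and> u * t6 * (v $ 3)\<^sup>2 = 0"
        by (smt (verit) zero_le_power2)
      then have "v = 0" using ut[OF u(2,3)] 4 u(4) by (auto simp: vec5_eq_iff)
      then show False using u(1) by simp
    qed
    moreover have "l \<noteq> u" "u \<noteq> m"
      using Dle[OF u(4) \<open>v $ 4 \<noteq> 0\<close> F0 u(2,3)] lm by auto
    moreover have "P v = (u - l) * (m - u) * (v $ 4)\<^sup>2"
      using u(4) by (simp add: P_def power2_eq_square algebra_simps)
    ultimately show ?thesis using u F0 by simp
  qed
  have cover: "v \<in> S1" if "norm v = 1" "F v = 0" "P v > 0" for v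
  proof -
    have n4: "v $ 4 \<noteq> 0"
    proof
      assume "v $ 4 = 0"
      then have "P v = - (v $ 5)\<^sup>2" by (simp add: P_def power2_eq_square)
      then show False using that(3) by (smt (verit) zero_le_power2)
    qed
    define u where "u = v $ 5 / v $ 4"
    have u: "v $ 5 = u * v $ 4" using n4 by (simp add: u_def)
    have "P v = (u - l) * (m - u) * (v $ 4)\<^sup>2"
      using u by (simp add: P_def power2_eq_square algebra_simps)
    then have "(u - l) * (m - u) > 0" using that(3) by (simp add: zero_less_mult_iff)
    then have "l \<le> u" "u \<le> m" using s by (auto simp: zero_less_mult_iff)
    moreover have "Q (v, u) = 0" using FQ[OF u] n4 that(2) by simp
    ultimately have "(v, u) \<in> K" using that(1) u by (simp add: K_def)
    then show ?thesis unfolding S1_def by (metis fst_conv imageI)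
  qed
  have Fhom: "F (c *s v) = 0" if "F v = 0" for c v
    using that threefold_form_scale[of a b1 b2 b3 b4 t2 t6 c v] by (simp add: F_def)
  have Fneg: "F (- v) = 0" if "F v = 0" for v
    using Fhom[OF that, of "-1"] by (simp add: scalar_mult_eq_scaleR)
  have Pscale: "P (c *s v) = c\<^sup>2 * P v" for c v
    by (simp add: P_def power2_eq_square algebra_simps)
  have Pneg: "P (- v) = P v" for v by (simp add: P_def algebra_simps)
  have "S1 \<noteq> {}"
  proof -
    \<comment> \<open>In diagonal coordinates over \<open>s\<close> this is the point with y1 =
      sqrt(-s D(s)), y2 = y3 = 0 and x4 = 1.\<close>
    define v :: "real^5" where "v = vector [sqrt (- (s * D s)) - (s * t2 + s\<^sup>2 * b1) / 2,
        - ((s * t2 + s\<^sup>2 * b2) / 2), - (s * b3 / (2 * t6)), 1, s]"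
    have "F v = 0"
      unfolding F_def using s(3)
      by (subst threefold_form_fibre[OF t6, of _ s]) (simp_all add: v_def D_def)
    moreover have "P v > 0" using s by (simp add: v_def P_def)
    moreover have v0: "v \<noteq> 0" by (simp add: v_def vec5_eq_iff)
    ultimately have "F ((1 / norm v) *s v) = 0" "P ((1 / norm v) *s v) > 0"
      using Fhom Pscale by auto
    moreover have "norm ((1 / norm v) *s v) = 1" using v0 by (simp add: scalar_mult_eq_scaleR)
    ultimately show ?thesis using cover by blast
  qed
  moreover have "S2 \<noteq> {}"
  proof -
    have "norm (vector [0, 0, 1, 0, 0] :: real^5) = 1" by (simp flip: axis_5(3))
    then have "vector [0, 0, 1, 0, 0] \<in> S2"
      by (simp add: S2_def F_def P_def threefold_form_def)
    then show ?thesis by blast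
  qed
  moreover have "S1 \<inter> S2 = {}" using S1p by (force simp: S2_def)
  moreover have "S1 \<union> S2 = {v. norm v = 1 \<and> F v = 0}"
    using S1p cover by (force simp: S2_def)
  moreover have "- v \<in> S1" if "v \<in> S1" for v
    using S1p[OF that] cover[of "- v"] Fneg Pneg by simp
  moreover have "- v \<in> S2" if "v \<in> S2" for v
    using that Fneg Pneg by (simp add: S2_def)
  ultimately show ?thesis
    using not_connectedin_hypersurface[of F S1 S2] Fhom S1c S2c by blast
qed

section \<open>Connectedness\<close>

lemma connected_component_path:
  fixes f :: "real \<Rightarrow> 'a::topological_space"
  assumes "continuous_on {0..1} f" "\<And>\<tau>. 0 \<le> \<tau> \<Longrightarrow> \<tau> \<le> 1 \<Longrightarrow> f \<tau> \<in> S"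
  shows "connected_component S (f 0) (f 1)"
  by (rule connected_componentI[of "f ` {0..1}"])
    (use assms in \<open>auto intro!: connected_continuous_image\<close>)

text \<open>Every point is joined to the punctured plane \<open>L\<close>, which is connected.
  Hypothesis \<open>H\<close> says that on the side \<open>u * t6 > 0\<close> a fibre with real
  points keeps them when \<open>u\<close> moves away from 0, so the path to infinity is
  free.\<close>

lemma threefold_connected:
  fixes a b1 b2 b3 b4 t2 t6 :: real
  defines "F \<equiv> threefold_form a b1 b2 b3 b4 t2 t6 :: real ^ 5 \<Rightarrow> real"
    and "D \<equiv> poly (Delta a b1 b2 b3 b4 t2 t6)"
  assumes t6: "t6 \<noteq> 0" and b: "b1 \<noteq> 0 \<or> b2 \<noteq> 0"
    and H: "\<And>u c. u * t6 > 0 \<Longrightarrow> u * D u \<le> 0 \<Longrightarrow> c \<ge> 1 \<Longrightarrow> u * D (c * u) \<le> 0"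
  shows "connected {v. v \<noteq> 0 \<and> F v = 0}"
proof -
  define V where "V = {v. v \<noteq> 0 \<and> F v = 0}"
  define L :: "(real^5) set" where "L = {v. v \<noteq> 0 \<and> v $ 4 = 0 \<and> v $ 5 = 0}"
  have LV: "L \<subseteq> V" by (auto simp: L_def V_def F_def threefold_form_def)
  have Lc: "connected L"
  proof -
    have "connected ((\<lambda>w :: real^3. vector [w $ 1, w $ 2, w $ 3, 0, 0] :: real^5) ` (- {0}))"
      by (intro connected_continuous_image continuous_intros connected_punctured_universe) simp
    moreover have "(\<lambda>w :: real^3. vector [w $ 1, w $ 2, w $ 3, 0, 0] :: real^5) ` (- {0}) = L"
    proof (intro equalityI subsetI)
      fix v assume "v \<in> L"
      then have "v = vector [vector [v $ 1, v $ 2, v $ 3] $ (1 :: 3), vector [v $ 1, v $ 2, v $ 3] $ (2 :: 3),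
          vector [v $ 1, v $ 2, v $ 3] $ (3 :: 3), 0, 0] \<and> (vector [v $ 1, v $ 2, v $ 3] :: real^3) \<noteq> 0"
        by (auto simp: L_def vec5_eq_iff vec_eq_iff forall_3 vector_3)
      then show "v \<in> (\<lambda>w :: real^3. vector [w $ 1, w $ 2, w $ 3, 0, 0] :: real^5) ` (- {0})"
        by (metis (no_types, lifting) ComplI imageI singletonD)
    qed (auto simp: L_def vec5_eq_iff vec_eq_iff forall_3)
    ultimately show ?thesis by simp
  qed
  have path: "\<exists>w\<in>L. connected_component V v w"
    if "continuous_on {0..1} f" "f 0 \<in> L" "f 1 = v"
      "\<And>\<tau>. 0 < \<tau> \<Longrightarrow> \<tau> \<le> 1 \<Longrightarrow> f \<tau> \<noteq> 0 \<and> F (f \<tau>) = 0" for f :: "real \<Rightarrow> real^5" and v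
  proof -
    have "f \<tau> \<in> V" if "0 \<le> \<tau>" "\<tau> \<le> 1" for \<tau>
    proof (cases "\<tau> = 0")
      case True
      then show ?thesis using LV \<open>f 0 \<in> L\<close> by auto
    next
      case False
      then have "0 < \<tau>" using that by simp
      then show ?thesis using that(2) \<open>\<And>\<tau>. 0 < \<tau> \<Longrightarrow> \<tau> \<le> 1 \<Longrightarrow> f \<tau> \<noteq> 0 \<and> F (f \<tau>) = 0\<close>
        by (simp add: V_def)
    qed
    then have "connected_component V (f 0) (f 1)"
      using connected_component_path \<open>continuous_on {0..1} f\<close> by metis
    then show ?thesis
      using \<open>f 0 \<in> L\<close> \<open>f 1 = v\<close> connected_component_sym by metis
  qed
  have to_L: "\<exists>w\<in>L. connected_component V v w" if vV: "v \<in> V" for v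
  proof -
    have v: "v \<noteq> 0" "F v = 0" using vV by (auto simp: V_def)
    show ?thesis
    proof (cases "v $ 4 = 0")
      case v4: True
      show ?thesis
      proof (cases "v $ 5 = 0")
        case True
        then have "v \<in> L" using v v4 by (simp add: L_def)
        then show ?thesis using vV connected_component_refl by metis
      next
        case v5: False
        text \<open>The section \<open>x\<^sub>4 = 0\<close> is a cone with vertex \<open>(- b2, b1, 0, 0, 0)\<close>.\<close>
        define f where "f = (\<lambda>\<tau>. vector [\<tau> * v $ 1 - (1 - \<tau>) * b2, \<tau> * v $ 2 + (1 - \<tau>) * b1,
            \<tau> * v $ 3, 0, \<tau> * v $ 5] :: real^5)"
        show ?thesis
        proof (rule path[of f])
          show "continuous_on {0..1} f" unfolding f_def by (intro continuous_intros)
          show "f 0 \<in> L" using b by (auto simp: f_def L_def vec5_eq_iff)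
          show "f 1 = v" using v4 by (simp add: f_def vec5_eq_iff)
          fix \<tau> :: real assume "0 < \<tau>" "\<tau> \<le> 1"
          then have "f \<tau> \<noteq> 0" using v5 by (simp add: f_def vec5_eq_iff)
          moreover have "F (f \<tau>) = \<tau> ^ 3 * F v"
            using v4 by (simp add: f_def F_def threefold_form_def power2_eq_square power3_eq_cube algebra_simps)
          ultimately show "f \<tau> \<noteq> 0 \<and> F (f \<tau>) = 0" using v by simp
        qed
      qed
    next
      case v4: False
      show ?thesis
      proof (cases "v $ 5 = 0")
        case v5: True
        have "(v $ 1)\<^sup>2 + (v $ 2)\<^sup>2 = 0"
          using v v4 v5 by (simp add: F_def threefold_form_def)
        then have v12: "v $ 1 = 0" "v $ 2 = 0" by (auto simp: sum_power2_eq_zero_iff)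
        \<comment> \<open>Here u = 0 and the residual quadric is x1^2 + x2^2 = 0. Its real points
          lie in the linear space x1 = x2 = x5 = 0, which is contained in the threefold, so a
          segment suffices.\<close>
        define f where "f = (\<lambda>\<tau>. vector [0, 0, \<tau> * v $ 3 + (1 - \<tau>), \<tau> * v $ 4, 0] :: real^5)"
        show ?thesis
        proof (rule path[of f])
          show "continuous_on {0..1} f" unfolding f_def by (intro continuous_intros)
          show "f 0 \<in> L" by (auto simp: f_def L_def vec5_eq_iff)
          show "f 1 = v" using v12 v5 by (simp add: f_def vec5_eq_iff)
          fix \<tau> :: real assume "0 < \<tau>" "\<tau> \<le> 1"
          then show "f \<tau> \<noteq> 0 \<and> F (f \<tau>) = 0" 
            using v4 by (simp add: f_def vec5_eq_iff F_def threefold_form_def)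
        qed
      next
        case v5: False
        define u where "u = v $ 5 / v $ 4"
        have u: "v $ 5 = u * v $ 4" "u \<noteq> 0" using v4 v5 by (simp_all add: u_def)
        define y1 y2 y3 where "y1 = v $ 1 + v $ 4 * (u * t2 + u\<^sup>2 * b1) / 2"
          and "y2 = v $ 2 + v $ 4 * (u * t2 + u\<^sup>2 * b2) / 2"
          and "y3 = v $ 3 + v $ 4 * u * b3 / (2 * t6)"
        have y: "y1\<^sup>2 + y2\<^sup>2 + u * t6 * y3\<^sup>2 + u * D u * (v $ 4)\<^sup>2 = 0"
          using threefold_form_fibre[OF t6 u(1), of a b1 b2 b3 b4 t2] v v4
          by (simp add: F_def D_def y1_def y2_def y3_def)
        have "u * t6 \<noteq> 0" using u t6 by simp
        then consider (neg) "u * t6 < 0" | (pos) "u * t6 > 0" by linarith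
        then show ?thesis
        proof cases
          case neg
          text \<open>Stay in the fibre over \<open>u\<close>, let \<open>x\<^sub>4\<close> tend to \<open>0\<close> and solve for \<open>y3\<close>. The shift by \<open>\<sigma>\<close>
            keeps the limit point nonzero.\<close>
          define \<sigma> :: real where "\<sigma> = (if y1 \<ge> 0 then 1 else - 1)"
          define z1 where "z1 = (\<lambda>\<tau>. y1 + (1 - \<tau>) * \<sigma>)"
          define N where "N = (\<lambda>\<tau>. ((z1 \<tau>)\<^sup>2 + y2\<^sup>2 + u * D u * (\<tau> * v $ 4)\<^sup>2) / (- (u * t6)))"
          have N0: "N \<tau> \<ge> 0" if "0 \<le> \<tau>" "\<tau> \<le> 1" for \<tau>
          proof -
            have t2: "\<tau>\<^sup>2 \<le> 1" using that by (simp add: power_le_one)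
            \<comment> \<open>The sign of \<open>\<sigma>\<close> moves \<open>z1\<close> away from
              0. The numerator of \<open>N\<close> is therefore at least the expression obtained
              from \<open>y\<close> after scaling by \<open>\<tau>\<^sup>2\<close>, which is
              nonnegative.\<close>
            have "\<bar>y1\<bar> \<le> \<bar>z1 \<tau>\<bar>" using that by (simp add: z1_def \<sigma>_def)
            then have 1: "y1\<^sup>2 \<le> (z1 \<tau>)\<^sup>2" by (simp add: abs_le_square_iff)
            have "\<tau>\<^sup>2 * (y1\<^sup>2 + y2\<^sup>2) \<le> y1\<^sup>2 + y2\<^sup>2"
              using t2 mult_right_mono[of "\<tau>\<^sup>2" 1 "y1\<^sup>2 + y2\<^sup>2"] by simp
            moreover have "\<tau>\<^sup>2 * (y1\<^sup>2 + y2\<^sup>2) + u * D u * (\<tau> * v $ 4)\<^sup>2 = \<tau>\<^sup>2 * ((- (u * t6)) * y3\<^sup>2)"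
              using y by (simp add: power_mult_distrib) algebra
            moreover have "\<tau>\<^sup>2 * ((- (u * t6)) * y3\<^sup>2) \<ge> 0"
              using neg by (intro mult_nonneg_nonneg) auto
            ultimately have "(z1 \<tau>)\<^sup>2 + y2\<^sup>2 + u * D u * (\<tau> * v $ 4)\<^sup>2 \<ge> 0" using 1 by linarith
            then show ?thesis using neg unfolding N_def by (intro divide_nonneg_pos) auto
          qed
          have N1: "sqrt (N 1) = \<bar>y3\<bar>"
          proof -
            have "N 1 = y3\<^sup>2" using y \<open>u * t6 \<noteq> 0\<close> by (simp add: N_def z1_def field_simps) 
            then show ?thesis by simp
          qed
          \<comment> \<open>The sign factor selects the square root that equals \<open>y3\<close> at
            \<open>\<tau> = 1\<close>; the subtracted terms undo the completed squares.\<close>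
          define f where "f = (\<lambda>\<tau>. vector [z1 \<tau> - \<tau> * v $ 4 * (u * t2 + u\<^sup>2 * b1) / 2,
              y2 - \<tau> * v $ 4 * (u * t2 + u\<^sup>2 * b2) / 2,
              (if y3 \<ge> 0 then 1 else - 1) * sqrt (N \<tau>) - \<tau> * v $ 4 * u * b3 / (2 * t6),
              \<tau> * v $ 4, u * (\<tau> * v $ 4)] :: real^5)"
          show ?thesis
          proof (rule path[of f])
            show "continuous_on {0..1} f"
              unfolding f_def N_def z1_def using \<open>u * t6 \<noteq> 0\<close> by (intro continuous_intros) auto
            have "z1 0 \<noteq> 0" by (simp add: z1_def \<sigma>_def)
            then show "f 0 \<in> L" by (simp add: f_def L_def vec5_eq_iff)
            show "f 1 = v"
              using N1 u(1) by (simp add: f_def vec5_eq_iff y1_def y2_def y3_def z1_def)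
            fix \<tau> :: real assume \<tau>: "0 < \<tau>" "\<tau> \<le> 1"
            then have "f \<tau> \<noteq> 0" using v4 by (simp add: f_def vec5_eq_iff)
            moreover have "F (f \<tau>) = 0"
            proof -
              have "(sqrt (N \<tau>))\<^sup>2 = N \<tau>" using N0 \<tau> by simp
              moreover have "u * t6 * N \<tau> = - ((z1 \<tau>)\<^sup>2 + y2\<^sup>2 + u * D u * (\<tau> * v $ 4)\<^sup>2)"
                using \<open>u * t6 \<noteq> 0\<close> by (simp add: N_def)
              ultimately show ?thesis
                unfolding F_def
                by (subst threefold_form_fibre[OF t6, of _ u])
                  (simp_all add: f_def power_mult_distrib flip: D_def)
            qed
            ultimately show "f \<tau> \<noteq> 0 \<and> F (f \<tau>) = 0" by simp
          qed
        next
          case pos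
          text \<open>Move to the fibre over \<open>u / \<tau>\<close> and let \<open>\<tau>\<close> tend to \<open>0\<close>; the coordinates are scaled by
            \<open>\<tau>\<^sup>2\<close>. The factor \<open>\<tau>\<close> in front of \<open>c\<close> and \<open>d\<close> makes the limit a multiple of \<open>(b1, b2, 0, 0, 0)\<close>.\<close>
          define N where "N = (\<lambda>\<tau>. - u * (v $ 4)\<^sup>2 * (- ((b1\<^sup>2 + b2\<^sup>2) / 4) * u ^ 3
              + (- 2 * t2 * t6 * (b1 + b2) - b3\<^sup>2 + 4 * a * t6) / (4 * t6) * u\<^sup>2 * \<tau>
              + (b4 - 1 / 2 * t2\<^sup>2) * u * \<tau>\<^sup>2 + t6 * \<tau> ^ 3))"
          have ND: "N \<tau> = - (u / \<tau>) * D (u / \<tau>) * (\<tau>\<^sup>2 * v $ 4)\<^sup>2" if "\<tau> \<noteq> 0" for \<tau>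
            using that t6 unfolding N_def D_def Delta_def
            by (simp add: field_simps power2_eq_square power3_eq_cube)
          have N1: "N 1 = y1\<^sup>2 + y2\<^sup>2 + u * t6 * y3\<^sup>2" using ND[of 1] y by simp
          have "u * t6 * y3\<^sup>2 \<ge> 0" using pos by simp
          then have "u * D u * (v $ 4)\<^sup>2 \<le> 0" using y by (smt (verit) zero_le_power2)
          then have uD: "u * D u \<le> 0" using v4 by (simp add: mult_le_0_iff)
          have N0: "N \<tau> \<ge> 0" if "0 < \<tau>" "\<tau> \<le> 1" for \<tau>
          proof -
            have "u * D (u / \<tau>) \<le> 0" using H[OF pos uD, of "1 / \<tau>"] that by simp
            then have "- (u * D (u / \<tau>)) / \<tau> * (\<tau>\<^sup>2 * v $ 4)\<^sup>2 \<ge> 0"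
              using that by (intro mult_nonneg_nonneg divide_nonneg_pos) auto
            then show ?thesis using ND[of \<tau>] that by simp
          qed
          define s where "s = sqrt (N 1)"
          have s2: "s\<^sup>2 = N 1" using N0[of 1] by (simp add: s_def)
          \<comment> \<open>The pair \<open>(c, d)\<close> lies in the unit disc and fixes the share
            of \<open>N\<close> taken by the first two squares. If \<open>s = 0\<close>, division by
            zero yields 0, which is consistent as then \<open>y1 = y2 = 0\<close>.\<close>
          define c d where "c = y1 / s" and "d = y2 / s"
          have s0: "y1 = 0 \<and> y2 = 0" if "s = 0"
            using s2 that N1 \<open>u * t6 * y3\<^sup>2 \<ge> 0\<close> by (smt (verit) zero_le_power2 power2_eq_iff zero_power2)
          have cs: "c * s = y1" "d * s = y2" using s0 by (auto simp: c_def d_def)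
          have cd: "c\<^sup>2 + d\<^sup>2 \<le> 1"
          proof (cases "s = 0")
            case False
            have "(c\<^sup>2 + d\<^sup>2) * s\<^sup>2 = y1\<^sup>2 + y2\<^sup>2"
              by (simp add: distrib_right flip: cs power_mult_distrib)
            then have "(c\<^sup>2 + d\<^sup>2) * s\<^sup>2 \<le> 1 * s\<^sup>2"
              using s2 N1 \<open>u * t6 * y3\<^sup>2 \<ge> 0\<close> by linarith
            then show ?thesis using False by simp
          qed (simp add: c_def d_def)
          \<comment> \<open>This is the square of the third diagonal coordinate, solved from the
            fibre equation; the leading factor \<open>\<tau>\<close> comes from dividing by
            \<open>u / \<tau> * t6\<close>.\<close>
          define E where "E = (\<lambda>\<tau>. \<tau> * N \<tau> * (1 - \<tau>\<^sup>2 * (c\<^sup>2 + d\<^sup>2)) / (u * t6))"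
          have E0: "E \<tau> \<ge> 0" if "0 < \<tau>" "\<tau> \<le> 1" for \<tau>
          proof -
            have "\<tau>\<^sup>2 * (c\<^sup>2 + d\<^sup>2) \<le> 1 * 1" using that cd by (intro mult_mono) (auto simp: power_le_one)
            then show ?thesis unfolding E_def
              using pos that N0[OF that] by (intro divide_nonneg_pos mult_nonneg_nonneg) auto
          qed
          have E1: "sqrt (E 1) = \<bar>y3\<bar>"
          proof -
            have "(c\<^sup>2 + d\<^sup>2) * s\<^sup>2 = y1\<^sup>2 + y2\<^sup>2"
              by (simp add: distrib_right flip: cs power_mult_distrib)
            then have "N 1 * (1 - (c\<^sup>2 + d\<^sup>2)) = u * t6 * y3\<^sup>2"
              using N1 s2 by (simp add: algebra_simps)
            then have "E 1 = y3\<^sup>2" using \<open>u * t6 \<noteq> 0\<close> by (simp add: E_def)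
            then show ?thesis by simp
          qed
          define f where "f = (\<lambda>\<tau>. vector [
              \<tau> * c * sqrt (N \<tau>) - v $ 4 * (\<tau> * u * t2 + u\<^sup>2 * b1) / 2,
              \<tau> * d * sqrt (N \<tau>) - v $ 4 * (\<tau> * u * t2 + u\<^sup>2 * b2) / 2,
              (if y3 \<ge> 0 then 1 else - 1) * sqrt (E \<tau>) - \<tau> * v $ 4 * u * b3 / (2 * t6),
              \<tau>\<^sup>2 * v $ 4, u * \<tau> * v $ 4] :: real^5)"
          show ?thesis
          proof (rule path[of f])
            show "continuous_on {0..1} f"
              unfolding f_def N_def E_def using \<open>u * t6 \<noteq> 0\<close> t6 by (intro continuous_intros) auto
            show "f 0 \<in> L" using b v4 u by (auto simp: f_def L_def vec5_eq_iff)
            show "f 1 = v"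
              using E1 u(1) cs by (simp add: f_def vec5_eq_iff y1_def y2_def y3_def flip: s_def)
            fix \<tau> :: real assume \<tau>: "0 < \<tau>" "\<tau> \<le> 1"
            then have "f \<tau> \<noteq> 0" using v4 by (simp add: f_def vec5_eq_iff)
            moreover have "F (f \<tau>) = 0"
            proof -
              define w where "w = u / \<tau>"
              have uw: "u = \<tau> * w" using \<tau> by (simp add: w_def)
              have f: "f \<tau> $ 5 = w * f \<tau> $ 4"
                "f \<tau> $ 1 + f \<tau> $ 4 * (w * t2 + w\<^sup>2 * b1) / 2 = \<tau> * c * sqrt (N \<tau>)"
                "f \<tau> $ 2 + f \<tau> $ 4 * (w * t2 + w\<^sup>2 * b2) / 2 = \<tau> * d * sqrt (N \<tau>)"
                "f \<tau> $ 3 + f \<tau> $ 4 * w * b3 / (2 * t6) = (if y3 \<ge> 0 then 1 else - 1) * sqrt (E \<tau>)"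
                by (simp_all add: f_def uw power2_eq_square field_simps)
              have "(sqrt (N \<tau>))\<^sup>2 = N \<tau>" "(sqrt (E \<tau>))\<^sup>2 = E \<tau>" using N0 E0 \<tau> by simp_all
              moreover have "w * t6 * E \<tau> = N \<tau> * (1 - \<tau>\<^sup>2 * (c\<^sup>2 + d\<^sup>2))"
                using \<open>u * t6 \<noteq> 0\<close> \<tau> by (simp add: E_def w_def)
              moreover have "w * D w * (f \<tau> $ 4)\<^sup>2 = - N \<tau>"
                using ND[of \<tau>] \<tau> by (simp add: w_def f_def)
              ultimately have "(\<tau> * c * sqrt (N \<tau>))\<^sup>2 + (\<tau> * d * sqrt (N \<tau>))\<^sup>2
                  + w * t6 * ((if y3 \<ge> 0 then 1 else - 1) * sqrt (E \<tau>))\<^sup>2 + w * D w * (f \<tau> $ 4)\<^sup>2 = 0"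
                by (simp add: power_mult_distrib algebra_simps)
              then show ?thesis
                using threefold_form_fibre[OF t6 f(1), of a b1 b2 b3 b4 t2]
                unfolding f(2-4) F_def D_def by simp
            qed
            ultimately show "f \<tau> \<noteq> 0 \<and> F (f \<tau>) = 0" by simp
          qed
        qed
      qed
    qed
  qed
  have "connected_component V v w" if vw: "v \<in> V" "w \<in> V" for v w
  proof -
    obtain v' w' where "v' \<in> L" "connected_component V v v'" "w' \<in> L" "connected_component V w w'"
      using to_L[OF vw(1)] to_L[OF vw(2)] by blast
    moreover have "connected_component V v' w'"
      using Lc LV calculation(1,3) by (intro connected_componentI)
    ultimately show ?thesis by (metis connected_component_trans connected_component_sym)
  qed
  then show ?thesis unfolding V_def by (simp add: connected_iff_connected_component)
qed

section \<open>Consequences of the hypotheses on singularities and planes\<close>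

text \<open>The identity matrix in the coordinates \<open>i, j, k\<close> certifies that the three
  generators are independent.\<close>

lemma span3_in_planes_in:
  fixes p q r :: "'a::field ^ 'n"
  assumes "p $ i = 1" "p $ j = 0" "p $ k = 0"
    and "q $ i = 0" "q $ j = 1" "q $ k = 0"
    and "r $ i = 0" "r $ j = 0" "r $ k = 1"
    and F: "\<And>a b c. F (a *s p + b *s q + c *s r) = 0"
  shows "vec.span {p, q, r} \<in> planes_in F"
proof -
  have spanD: "\<exists>a b. v = a *s q + b *s r" if "v \<in> vec.span {q, r}" for v
    using that by (force simp: vec.span_insert algebra_simps eq_diff_eq)
  have ne: "p \<noteq> q" "p \<noteq> r" "q \<noteq> r" using assms by auto
  have "q \<notin> vec.span {r}" using assms by (auto simp: vec.span_singleton)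
  moreover have "p \<notin> vec.span {q, r}"
  proof
    assume "p \<in> vec.span {q, r}"
    then obtain a b where "p = a *s q + b *s r" using spanD by blast
    then have "p $ i = 0" using assms by simp
    then show False using assms by simp
  qed
  moreover have "r \<noteq> 0" using assms by auto
  ultimately have "vec.independent {p, q, r}"
    using ne by (simp add: vec.independent_insert)
  then have "vec.dim (vec.span {p, q, r}) = 3"
    using ne by (simp add: vec.dim_eq_card_independent)
  moreover have "F v = 0" if v: "v \<in> vec.span {p, q, r}" for v
  proof -
    obtain a where "v - a *s p \<in> vec.span {q, r}" using v by (auto simp: vec.span_insert)
    then obtain b c where "v - a *s p = b *s q + c *s r" using spanD by blast
    then have "v = a *s p + b *s q + c *s r" by (simp add: algebra_simps)
    then show ?thesis using F by simp
  qed
  ultimately show ?thesis by (simp add: planes_in_def)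
qed

text \<open>Used to tell planes apart by the linear forms x4, x5 and i x1 - x2.\<close>

lemma functional_zero_on_span:
  fixes x y :: "'a::field"
  assumes "v \<in> vec.span S" "\<And>w. w \<in> S \<Longrightarrow> x * w $ i + y * w $ j = 0"
  shows "x * v $ i + y * v $ j = 0"
  using assms(1)
proof (induction rule: vec.span_induct_alt)
  case (step c w v)
  have "x * (c *s w + v) $ i + y * (c *s w + v) $ j = c * (x * w $ i + y * w $ j) + (x * v $ i + y * v $ j)"
    by (simp add: algebra_simps)
  then show ?case using step assms(2) by simp
qed simp

lemma complex_quadratic_root:
  fixes p q r :: complex
  assumes "p \<noteq> 0"
  obtains z where "p * z\<^sup>2 + q * z + r = 0"
proof -
  define z where "z = (csqrt (q\<^sup>2 - 4 * p * r) - q) / (2 * p)"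
  have "(2 * p * z + q)\<^sup>2 = q\<^sup>2 - 4 * p * r" using assms by (simp add: z_def)
  then have "4 * p * (p * z\<^sup>2 + q * z + r) = 0" by (simp add: power2_eq_square algebra_simps)
  then show ?thesis using that assms by simp
qed

text \<open>The section x5 = 0 is x4 (x1^2 + x2^2) = 0 and contributes the planes \<open>P0\<close>,
  \<open>P1\<close>, \<open>P2\<close>. If b1 = b2 = 0, the section x4 = 0 is x5 (t6 x3^2 + b3 x3 x5
  + a x5^2) = 0, and a complex root of the quadratic factor gives \<open>P3\<close>.\<close>

lemma four_planes:
  fixes a b3 b4 t2 t6 :: real
  assumes "t6 \<noteq> 0"
  shows "card (planes_in (threefold_form a 0 0 b3 b4 t2 t6 :: complex ^ 5 \<Rightarrow> complex)) \<noteq> 3"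
proof
  let ?F = "threefold_form a 0 0 b3 b4 t2 t6 :: complex ^ 5 \<Rightarrow> complex"
  assume card: "card (planes_in ?F) = 3"
  obtain \<rho> where \<rho>: "of_real t6 * \<rho>\<^sup>2 + of_real b3 * \<rho> + of_real a = (0 :: complex)"
    using assms complex_quadratic_root[of "of_real t6" "of_real b3" "of_real a"] by auto
  define P0 :: "(complex^5) set" where
    "P0 = vec.span {vector [1, 0, 0, 0, 0], vector [0, 1, 0, 0, 0], vector [0, 0, 1, 0, 0]}"
  define P1 :: "(complex^5) set" where
    "P1 = vec.span {vector [1, \<i>, 0, 0, 0], vector [0, 0, 1, 0, 0], vector [0, 0, 0, 1, 0]}"
  define P2 :: "(complex^5) set" where
    "P2 = vec.span {vector [1, - \<i>, 0, 0, 0], vector [0, 0, 1, 0, 0], vector [0, 0, 0, 1, 0]}"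
  define P3 :: "(complex^5) set" where
    "P3 = vec.span {vector [1, 0, 0, 0, 0], vector [0, 1, 0, 0, 0], vector [0, 0, \<rho>, 0, 1]}"
  have "P0 \<in> planes_in ?F" unfolding P0_def
    by (rule span3_in_planes_in[where i = 1 and j = 2 and k = 3]) (simp_all add: threefold_form_def)
  moreover have "P1 \<in> planes_in ?F" unfolding P1_def
    by (rule span3_in_planes_in[where i = 1 and j = 3 and k = 4])
      (simp_all add: threefold_form_def power_mult_distrib)
  moreover have "P2 \<in> planes_in ?F" unfolding P2_def
    by (rule span3_in_planes_in[where i = 1 and j = 3 and k = 4])
      (simp_all add: threefold_form_def power_mult_distrib)
  moreover have "P3 \<in> planes_in ?F" unfolding P3_def
  proof (rule span3_in_planes_in[where i = 1 and j = 2 and k = 5])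
    fix x y z :: complex
    have "?F (x *s vector [1, 0, 0, 0, 0] + y *s vector [0, 1, 0, 0, 0] + z *s vector [0, 0, \<rho>, 0, 1])
        = z ^ 3 * (of_real t6 * \<rho>\<^sup>2 + of_real b3 * \<rho> + of_real a)"
      by (simp add: threefold_form_def power2_eq_square power3_eq_cube algebra_simps)
    then show "?F (x *s vector [1, 0, 0, 0, 0] + y *s vector [0, 1, 0, 0, 0] + z *s vector [0, 0, \<rho>, 0, 1]) = 0"
      using \<rho> by simp
  qed simp_all
  moreover have "card {P0, P1, P2, P3} = 4"
  proof -
    have "1 * v $ 4 + 0 * v $ 4 = 0" if "v \<in> P0 \<or> v \<in> P3" for v
      using that unfolding P0_def P3_def
      by (elim disjE) (erule functional_zero_on_span, force)+
    then have 4: "v $ 4 = 0" if "v \<in> P0 \<or> v \<in> P3" for v using that by simp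
    have "1 * v $ 5 + 0 * v $ 5 = 0" if "v \<in> P0" for v
      using that unfolding P0_def by (rule functional_zero_on_span) force
    then have 5: "v $ 5 = 0" if "v \<in> P0" for v using that by simp
    have 1: "\<i> * v $ 1 + (- 1) * v $ 2 = 0" if "v \<in> P1" for v
      using that unfolding P1_def by (rule functional_zero_on_span) force
    have "vector [0, 0, 0, 1, 0] \<in> P1" "vector [0, 0, 0, 1, 0] \<in> P2"
      "vector [0, 0, \<rho>, 0, 1] \<in> P3" "vector [1, - \<i>, 0, 0, 0] \<in> P2"
      by (auto simp: P1_def P2_def P3_def intro: vec.span_base)
    then have "P0 \<noteq> P1" "P0 \<noteq> P2" "P0 \<noteq> P3" "P1 \<noteq> P2" "P1 \<noteq> P3" "P2 \<noteq> P3"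
      using 4 5 1 by (force+)
    then show ?thesis by simp
  qed
  \<comment> \<open>An infinite set has \<open>card\<close> 0, so \<open>card\<close> 3 entails
    finiteness.\<close>
  moreover have "finite (planes_in ?F)" using card by (simp add: card_ge_0_finite)
  ultimately show False
    using card card_mono[of "planes_in ?F" "{P0, P1, P2, P3}"] by simp
qed

section \<open>Real singular points\<close>

lemma partial_deriv_threefold_form:
  fixes v :: "real ^ 5"
  shows "partial_deriv 1 (threefold_form a b1 b2 b3 b4 t2 t6) v =
      2 * v $ 1 * v $ 4 + b1 * (v $ 5)\<^sup>2 + t2 * v $ 4 * v $ 5"
    "partial_deriv 2 (threefold_form a b1 b2 b3 b4 t2 t6) v =
      2 * v $ 2 * v $ 4 + b2 * (v $ 5)\<^sup>2 + t2 * v $ 4 * v $ 5"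
    "partial_deriv 3 (threefold_form a b1 b2 b3 b4 t2 t6) v = b3 * (v $ 5)\<^sup>2 + 2 * t6 * v $ 3 * v $ 5"
    "partial_deriv 4 (threefold_form a b1 b2 b3 b4 t2 t6) v =
      (v $ 1)\<^sup>2 + (v $ 2)\<^sup>2 + b4 * (v $ 5)\<^sup>2 + v $ 5 * (t2 * (v $ 1 + v $ 2) + 2 * t6 * v $ 4)"
    "partial_deriv 5 (threefold_form a b1 b2 b3 b4 t2 t6) v =
      3 * a * (v $ 5)\<^sup>2 + 2 * v $ 5 * (b1 * v $ 1 + b2 * v $ 2 + b3 * v $ 3 + b4 * v $ 4)
      + t2 * (v $ 1 + v $ 2) * v $ 4 + t6 * ((v $ 3)\<^sup>2 + (v $ 4)\<^sup>2)"
  unfolding partial_deriv_def threefold_form_def axis_5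
  by (rule DERIV_imp_deriv, auto intro!: derivative_eq_intros simp: power2_eq_square algebra_simps)+

text \<open>At the point (0, 0, 1, 0, 0) of the threefold the only partial derivative that can be
  nonzero is the fifth, with value \<open>t6\<close>.\<close>

lemma t6_nonzero:
  fixes a b1 b2 b3 b4 t2 t6 :: real
  assumes "sing_locus (threefold_form a b1 b2 b3 b4 t2 t6 :: real ^ 5 \<Rightarrow> real) = {}"
  shows "t6 \<noteq> 0"
proof
  assume "t6 = 0"
  then have "threefold_form a b1 b2 b3 b4 t2 t6 (vector [0, 0, 1, 0, 0] :: real^5) = 0 \<and>
      (\<forall>i. partial_deriv i (threefold_form a b1 b2 b3 b4 t2 t6) (vector [0, 0, 1, 0, 0] :: real^5) = 0)"
    by (simp add: forall_5 partial_deriv_threefold_form threefold_form_def)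
  moreover have "vector [0, 0, 1, 0, 0] \<noteq> (0 :: real^5)" by (simp add: vec5_eq_iff)
  ultimately show False using assms by (auto simp: sing_locus_def)
qed

text \<open>At the point over \<open>s\<close> with y1 = y2 = y3 = 0 and x4 = 1, the form is s D(s),
  its first three partial derivatives vanish, and the last two are 2 s D(s) - s^2 D'(s) and D(s) + s
  D'(s). A multiple root would make it singular.\<close>

lemma Delta_roots_simple:
  fixes a b1 b2 b3 b4 t2 t6 s :: real
  assumes sing: "sing_locus (threefold_form a b1 b2 b3 b4 t2 t6 :: real ^ 5 \<Rightarrow> real) = {}"
    and root: "poly (Delta a b1 b2 b3 b4 t2 t6) s = 0"
  shows "poly (pderiv (Delta a b1 b2 b3 b4 t2 t6)) s \<noteq> 0"
proof
  assume droot: "poly (pderiv (Delta a b1 b2 b3 b4 t2 t6)) s = 0"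
  have t6: "t6 \<noteq> 0" using t6_nonzero[OF sing] .
  define v :: "real^5" where "v = vector [- (s * t2 + s\<^sup>2 * b1) / 2, - (s * t2 + s\<^sup>2 * b2) / 2,
      - (s * b3) / (2 * t6), 1, s]"
  \<comment> \<open>Replacing \<open>a\<close> by the quadratic coefficient \<open>c\<close> lets
    the form and its derivatives be compared with \<open>Delta\<close> directly.\<close>
  define c where "c = (- 2 * t2 * t6 * (b1 + b2) - b3\<^sup>2 + 4 * a * t6) / (4 * t6)"
  have a: "a = c + t2 * (b1 + b2) / 2 + b3\<^sup>2 / (4 * t6)" using t6 by (simp add: c_def field_simps)
  have D: "Delta a b1 b2 b3 b4 t2 t6 = [:t6, b4 - t2\<^sup>2 / 2, c, - ((b1\<^sup>2 + b2\<^sup>2) / 4):]"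
    by (simp add: Delta_def c_def)
  have r0: "t6 + s * (b4 - t2\<^sup>2 / 2) + s\<^sup>2 * c - s ^ 3 * (b1\<^sup>2 + b2\<^sup>2) / 4 = 0"
    using root unfolding D by (simp add: algebra_simps power2_eq_square power3_eq_cube)
  have r1: "(b4 - t2\<^sup>2 / 2) + 2 * s * c - 3 * s\<^sup>2 * (b1\<^sup>2 + b2\<^sup>2) / 4 = 0"
    using droot unfolding D by (simp add: pderiv_pCons algebra_simps power2_eq_square)
  have "threefold_form a b1 b2 b3 b4 t2 t6 v =
      s * (t6 + s * (b4 - t2\<^sup>2 / 2) + s\<^sup>2 * c - s ^ 3 * (b1\<^sup>2 + b2\<^sup>2) / 4)"
    using t6 unfolding threefold_form_def v_def a
    by (simp add: power2_eq_square power3_eq_cube field_simps)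
  then have "threefold_form a b1 b2 b3 b4 t2 t6 v = 0" using r0 by simp
  moreover have "\<forall>i. partial_deriv i (threefold_form a b1 b2 b3 b4 t2 t6) v = 0"
  proof -
    have "partial_deriv 4 (threefold_form a b1 b2 b3 b4 t2 t6) v =
        2 * s * (t6 + s * (b4 - t2\<^sup>2 / 2) + s\<^sup>2 * c - s ^ 3 * (b1\<^sup>2 + b2\<^sup>2) / 4)
        - s\<^sup>2 * ((b4 - t2\<^sup>2 / 2) + 2 * s * c - 3 * s\<^sup>2 * (b1\<^sup>2 + b2\<^sup>2) / 4)"
      unfolding partial_deriv_threefold_form using t6
      by (simp add: v_def power2_eq_square power3_eq_cube field_simps)
    moreover have "partial_deriv 5 (threefold_form a b1 b2 b3 b4 t2 t6) v =
        (t6 + s * (b4 - t2\<^sup>2 / 2) + s\<^sup>2 * c - s ^ 3 * (b1\<^sup>2 + b2\<^sup>2) / 4)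
        + s * ((b4 - t2\<^sup>2 / 2) + 2 * s * c - 3 * s\<^sup>2 * (b1\<^sup>2 + b2\<^sup>2) / 4)"
      unfolding partial_deriv_threefold_form a using t6
      by (simp add: v_def power2_eq_square power3_eq_cube field_simps)
    ultimately have "partial_deriv 4 (threefold_form a b1 b2 b3 b4 t2 t6) v = 0"
      "partial_deriv 5 (threefold_form a b1 b2 b3 b4 t2 t6) v = 0"
      using r0 r1 by simp_all
    moreover have "partial_deriv 1 (threefold_form a b1 b2 b3 b4 t2 t6) v = 0"
      "partial_deriv 2 (threefold_form a b1 b2 b3 b4 t2 t6) v = 0"
      "partial_deriv 3 (threefold_form a b1 b2 b3 b4 t2 t6) v = 0"
      unfolding partial_deriv_threefold_form using t6
      by (simp_all add: v_def power2_eq_square field_simps)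
    ultimately show ?thesis by (simp add: forall_5)
  qed
  moreover have "v \<noteq> 0" by (simp add: v_def vec5_eq_iff)
  ultimately show False using sing by (auto simp: sing_locus_def)
qed

section \<open>The connectedness criterion\<close>

theorem proposition4p4:
  fixes a b1 b2 b3 b4 t2 t6 :: real
    and X :: "real ^ 5 \<Rightarrow> real" and XC :: "complex ^ 5 \<Rightarrow> complex"
  assumes X: "X = threefold_form a b1 b2 b3 b4 t2 t6"
    and XC: "XC = threefold_form a b1 b2 b3 b4 t2 t6"
    and no_real_sing: "sing_locus X = {}"
    and sing: "sing_locus XC =
      {vec.span {vector [1, \<i>, 0, 0, 0]}, vec.span {vector [1, - \<i>, 0, 0, 0]},
       vec.span {vector [0, 0, 1, \<i>, 0]}, vec.span {vector [0, 0, 1, - \<i>, 0]}}"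
    and A3: "is_A_point 3 XC (vec.span {vector [1, \<i>, 0, 0, 0]})"
      "is_A_point 3 XC (vec.span {vector [1, - \<i>, 0, 0, 0]})"
    and A1: "is_A_point 1 XC (vec.span {vector [0, 0, 1, \<i>, 0]})"
      "is_A_point 1 XC (vec.span {vector [0, 0, 1, - \<i>, 0]})"
    and three_planes: "card (planes_in XC) = 3"
  shows "\<not> connectedin real_proj_topology (hypersurface X) \<longleftrightarrow>
    (\<exists>\<alpha>1 \<alpha>2 \<alpha>3. \<alpha>1 < \<alpha>2 \<and> \<alpha>2 < \<alpha>3 \<and>
       {s. poly (Delta a b1 b2 b3 b4 t2 t6) s = 0} = {\<alpha>1, \<alpha>2, \<alpha>3} \<and>
       (t6 > 0 \<and> 0 < \<alpha>1 \<or> t6 < 0 \<and> \<alpha>3 < 0))"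
    (is "_ \<longleftrightarrow> ?R")
proof -
  let ?D = "Delta a b1 b2 b3 b4 t2 t6"
  have t6: "t6 \<noteq> 0" using t6_nonzero no_real_sing X by blast
  have b: "b1 \<noteq> 0 \<or> b2 \<noteq> 0" using four_planes[OF t6] three_planes XC by auto
  have simple: "poly (pderiv ?D) s \<noteq> 0" if "poly ?D s = 0" for s
    using Delta_roots_simple no_real_sing X that by blast
  obtain c1 c2 c3 where D: "?D = [:t6, c1, c2, c3:]" and c3: "c3 < 0"
  proof
    show "?D = [:t6, b4 - 1 / 2 * t2\<^sup>2, (- 2 * t2 * t6 * (b1 + b2) - b3\<^sup>2 + 4 * a * t6) / (4 * t6),
        - ((b1\<^sup>2 + b2\<^sup>2) / 4):]" by (simp add: Delta_def)
    show "- ((b1\<^sup>2 + b2\<^sup>2) / 4) < 0" using b by (simp add: sum_power2_gt_zero_iff)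
  qed
  have "\<not> connectedin real_proj_topology (hypersurface X)" if ?R
  proof -
    from that obtain x y z where o: "x < y" "y < z" and roots: "{s. poly ?D s = 0} = {x, y, z}"
      and sgn: "t6 > 0 \<and> 0 < x \<or> t6 < 0 \<and> z < 0" by blast
    have r: "poly ?D x = 0" "poly ?D y = 0" "poly ?D z = 0" using roots by auto
    then have fac: "poly ?D s = c3 * (s - x) * (s - y) * (s - z)" for s
      unfolding D by (intro cubic_factorization) (use o in auto)
    have ev: "s * poly ?D s > 0 \<longleftrightarrow> s * ((s - x) * ((s - y) * (s - z))) < 0" for s
    proof -
      have "s * poly ?D s = c3 * (s * ((s - x) * ((s - y) * (s - z))))" by (simp add: fac)
      then show ?thesis using c3 by (simp only: zero_less_mult_iff) auto
    qed
    from sgn show ?thesis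
    proof
      assume s: "t6 > 0 \<and> 0 < x"
      show ?thesis unfolding X
      \<comment> \<open>Since the leading coefficient is negative, \<open>Delta\<close> is positive
        on (0, x) and (y, z) and nonpositive on [x, y]; \<open>l\<close> and \<open>m\<close>
        enclose that last interval.\<close>
      proof (rule threefold_disconnected[where l = "x / 2" and m = "(y + z) / 2" and s = x])
        show "x / 2 * poly ?D (x / 2) > 0"
          unfolding ev using s o by (intro mult_pos_neg[OF _ mult_neg_pos[OF _ mult_neg_neg]]) auto
        show "(y + z) / 2 * poly ?D ((y + z) / 2) > 0"
          unfolding ev using s o by (intro mult_pos_neg[OF _ mult_pos_neg[OF _ mult_pos_neg]]) auto
      qed (use s o r in auto)
    next
      assume s: "t6 < 0 \<and> z < 0"
      show ?thesis unfolding X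
      \<comment> \<open>For negative \<open>u\<close> the sign condition is reversed: the fibres
        with real points near \<open>s\<close> lie over [y, z], where \<open>Delta\<close> is
        nonnegative.\<close>
      proof (rule threefold_disconnected[where l = "(x + y) / 2" and m = "z / 2" and s = z])
        show "(x + y) / 2 * poly ?D ((x + y) / 2) > 0"
          unfolding ev using s o by (intro mult_neg_pos[OF _ mult_pos_pos[OF _ mult_neg_neg]]) auto
        show "z / 2 * poly ?D (z / 2) > 0"
          unfolding ev using s o by (intro mult_neg_pos[OF _ mult_pos_pos[OF _ mult_pos_pos]]) auto
      qed (use s o r in \<open>auto simp: mult_neg_neg\<close>)
    qed
  qed
  moreover have "connectedin real_proj_topology (hypersurface X)" if notR: "\<not> ?R"
  proof -
    \<comment> \<open>A failure would give, up to reflection, \<open>Delta\<close> positive at 0,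
      nonpositive at \<open>u\<close> and positive again at \<open>c * u\<close>, hence the three
      roots excluded by \<open>notR\<close>.\<close>
    have "u * poly ?D (c * u) \<le> 0" if u: "u * t6 > 0" "u * poly ?D u \<le> 0" "c \<ge> 1" for u c
    proof (rule ccontr)
      assume "\<not> u * poly ?D (c * u) \<le> 0"
      then have neg: "u * poly ?D (c * u) > 0" by simp
      then have c: "c > 1" using u by (cases "c = 1") auto
      from t6 consider (pos) "t6 > 0" | (neg) "t6 < 0" by linarith
      then show False
      proof cases
        case pos
        have "u > 0" using u(1) pos by (simp add: zero_less_mult_iff)
        then have "0 < u" "u < c * u" "poly ?D u \<le> 0" "poly ?D (c * u) > 0"
          using u neg c by (auto simp: mult_le_0_iff zero_less_mult_iff)
        then obtain x y z where "0 < x" "x < y" "y < z" "{s. poly ?D s = 0} = {x, y, z}"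
          using cubic_three_positive_roots[of t6 c3 c1 c2 u "c * u"] pos c3 simple unfolding D by blast
        then show False using notR pos by blast
      next
        case neg6: neg
        \<comment> \<open>The reflection s -> -D(-s) keeps the negative leading coefficient and
          makes the constant term positive, reducing this case to positive roots.\<close>
        let ?g = "[:- t6, c1, - c2, c3:]"
        have g: "poly ?g s = - poly ?D (- s)" for s unfolding D by (simp add: algebra_simps)
        have dg: "poly (pderiv ?g) s = poly (pderiv ?D) (- s)" for s
          unfolding D by (simp add: pderiv_pCons algebra_simps)
        have "u < 0" using u(1) neg6 by (simp add: zero_less_mult_iff)
        then have pq: "0 < - u" "- u < - (c * u)" "poly ?g (- u) \<le> 0" "poly ?g (- (c * u)) > 0"
          using u neg c unfolding g by (auto simp: mult_le_0_iff zero_less_mult_iff)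
        have gs: "poly (pderiv ?g) s \<noteq> 0" if "poly ?g s = 0" for s
          using simple[of "- s"] that unfolding g dg by simp
        have "- t6 > 0" using neg6 by simp
        then obtain x y z where xyz: "0 < x" "x < y" "y < z" "{s. poly ?g s = 0} = {x, y, z}"
          using cubic_three_positive_roots[OF _ c3 gs pq] by blast
        have "poly ?D s = 0 \<longleftrightarrow> - s \<in> {s. poly ?g s = 0}" for s by (simp add: g del: poly_pCons)
        moreover have "- s \<in> {x, y, z} \<longleftrightarrow> s \<in> {- z, - y, - x}" for s
          by (metis (no_types, opaque_lifting) insert_iff empty_iff minus_minus)
        ultimately have "{s. poly ?D s = 0} = {- z, - y, - x}" unfolding xyz(4) by blast
        moreover have "- z < - y" "- y < - x" "- x < 0" using xyz by auto
        ultimately show False using notR neg6 by blast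
      qed
    qed
    then show ?thesis
      unfolding X by (intro connectedin_hypersurface threefold_connected[OF t6 b])
  qed
  ultimately show ?thesis by blast
qed

end
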